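(* Let $\pi_1,\pi_2$ be two strictly positive possibility distributions on a finite set $\mathcal{X}$ (that is, $\pi_i(x)>0$ for all $x\in\mathcal{X}$ and $i\in\{1,2\}$), with induced possibility measures $\Pi_1,\Pi_2$. Let $\overline{P}(A)=\min\{\Pi_1(A),\Pi_2(A)\}$ for all $A\subseteq\mathcal{X}$, and let $\overline{E}$ be the natural extension of $\overline{P}$. Then $\overline{E}$ is a possibility measure if and only if $\overline{P}$ is a possibility measure.
   Context: $\mathcal{X}$ is a finite set and $\wp(\mathcal{X})$ its power set. A possibility distribution on $\mathcal{X}$ is a function $\pi\colon\mathcal{X}\to[0,1]$ with $\max_{x\in\mathcal{X}}\pi(x)=1$. It induces the possibility measure $\Pi\colon\wp(\mathcal{X})\to[0,1]$, $\Pi(A)=\max_{x\in A}\pi(x)$, with $\Pi(\emptyset)=0$. A set function is called a possibility measure if it is induced in this way by some possibility distribution. An upper probability is a function $\overline{P}\colon\wp(\mathcal{X})\to[0,1]$. Its credal set $\mathcal{M}$ is the set of all (finitely additive) probability measures $Q$ on $\wp(\mathcal{X})$ with $Q(A)\le\overline{P}(A)$ for all $A\subseteq\mathcal{X}$. $\overline{P}$ avoids sure loss if $\mathcal{M}\neq\emptyset$; in that case its natural extension is $\overline{E}(A)=\max_{Q\in\mathcal{M}}Q(A)$ for $A\subseteq\mathcal{X}$. The phrase "$\overline{E}$ is a possibility measure" means that $\overline{P}$ avoids sure loss (so that $\overline{E}$ exists) and $\overline{E}$ is a possibility measure. *)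

theory Defs
  imports "HOL-Analysis.Analysis"
begin

(* The underlying finite set is modelled as the universe of a type of class finite, so that set
   functions on its power set are total functions 'a set \<Rightarrow> real. *)

definition possibility_distribution :: "('a::finite \<Rightarrow> real) \<Rightarrow> bool" where
  "possibility_distribution \<pi> \<longleftrightarrow> (\<forall>x. 0 \<le> \<pi> x \<and> \<pi> x \<le> 1) \<and> Max (range \<pi>) = 1"

definition possibility_measure_of :: "('a::finite \<Rightarrow> real) \<Rightarrow> 'a set \<Rightarrow> real" where
  "possibility_measure_of \<pi> A = (if A = {} then 0 else Max (\<pi> ` A))"

definition possibility_measure :: "('a::finite set \<Rightarrow> real) \<Rightarrow> bool" where
  "possibility_measure U \<longleftrightarrow>
     (\<exists>\<pi>. possibility_distribution \<pi> \<and> U = possibility_measure_of \<pi>)"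

definition finitely_additive_probability :: "('a::finite set \<Rightarrow> real) \<Rightarrow> bool" where
  "finitely_additive_probability Q \<longleftrightarrow>
     (\<forall>A. 0 \<le> Q A) \<and> Q UNIV = 1 \<and> (\<forall>A B. A \<inter> B = {} \<longrightarrow> Q (A \<union> B) = Q A + Q B)"

definition credal_set :: "('a::finite set \<Rightarrow> real) \<Rightarrow> ('a set \<Rightarrow> real) set" where
  "credal_set P = {Q. finitely_additive_probability Q \<and> (\<forall>A. Q A \<le> P A)}"

definition avoids_sure_loss :: "('a::finite set \<Rightarrow> real) \<Rightarrow> bool" where
  "avoids_sure_loss P \<longleftrightarrow> credal_set P \<noteq> {}"

(* The credal set is in general infinite, so Max is not applicable. That the maximum exists whenever
   P avoids sure loss is natural_extension_attained below; otherwise the value is unspecified. *)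
definition natural_extension :: "('a::finite set \<Rightarrow> real) \<Rightarrow> 'a set \<Rightarrow> real" where
  "natural_extension P A = (GREATEST v. \<exists>Q\<in>credal_set P. v = Q A)"

lemma finitely_additive_probability_le_1:
  assumes "finitely_additive_probability Q"
  shows "Q A \<le> 1"
proof -
  have "Q (A \<union> - A) = Q A + Q (- A)" "0 \<le> Q (- A)" "Q UNIV = 1"
    using assms unfolding finitely_additive_probability_def by blast+
  then show ?thesis by simp
qed

lemma compact_credal_set: "compact (credal_set P)"
proof -
  have "compact (PiE UNIV (\<lambda>_. {0..1}) :: ('a set \<Rightarrow> real) set)"
    unfolding compactin_euclidean_iff[symmetric] euclidean_product_topology[symmetric]
    by (simp add: compactin_PiE)
  moreover have "closed (credal_set P)"
    unfolding credal_set_def finitely_additive_probability_def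
    by (intro closed_Collect_conj closed_Collect_all closed_Collect_imp closed_Collect_le
          closed_Collect_eq continuous_intros continuous_on_product_coordinates open_Collect_const)
  moreover have "credal_set P \<subseteq> PiE UNIV (\<lambda>_. {0..1})"
    by (auto simp: credal_set_def finitely_additive_probability_le_1)
       (auto simp: finitely_additive_probability_def)
  ultimately show ?thesis
    by (metis compact_Int_closed inf.absorb_iff2)
qed

lemma natural_extension_attained:
  assumes "avoids_sure_loss P"
  shows "\<exists>Q\<in>credal_set P. natural_extension P A = Q A"
    and "Q \<in> credal_set P \<Longrightarrow> Q A \<le> natural_extension P A"
proof -
  obtain R where R: "R \<in> credal_set P" "\<And>Q. Q \<in> credal_set P \<Longrightarrow> Q A \<le> R A"
    using continuous_attains_sup[OF compact_credal_set, of P "\<lambda>Q. Q A"] assms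
    unfolding avoids_sure_loss_def
    by (auto intro: continuous_on_product_coordinates continuous_on_subset)
  then have "natural_extension P A = R A"
    unfolding natural_extension_def by (intro Greatest_equality) auto
  then show "\<exists>Q\<in>credal_set P. natural_extension P A = Q A"
    and "Q \<in> credal_set P \<Longrightarrow> Q A \<le> natural_extension P A"
    using R by auto
qed

end

theory Submission
  imports Defs
begin

text \<open>
  The credal set of a monotone upper probability \<open>U\<close> with \<open>U {z} = 1\<close> for some point \<open>z\<close> contains
  many measures with at most three atoms: any masses on \<open>a\<close> and \<open>b\<close> that respect the bounds
  \<open>U {a}\<close>, \<open>U {b}\<close> and \<open>U {a, b}\<close> are admissible, because the remaining mass can be put on \<open>z\<close>,
  where every event already has upper probability 1 (\<open>three_atoms_in_credal_set\<close>).

  A possibility measure is therefore its own natural extension: the value of an event is attained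
  by a measure with one atom at a most possible point of the event and the rest at a point of
  possibility 1 (\<open>natural_extension_possibility_measure\<close>).

  Conversely, let the natural extension \<open>E\<close> of \<open>U\<close> be a possibility measure. Such an \<open>E\<close> lies
  below \<open>U\<close> and some \<open>E {z}\<close> equals 1, so the three-atom measures exist. If \<open>U {a, b}\<close> were larger
  than both \<open>U {a}\<close> and \<open>U {b}\<close>, a measure could charge \<open>a\<close> with all of \<open>U {a}\<close> and put a further
  positive amount on \<open>b\<close>, and the total could be pushed above \<open>U {b}\<close> as well; positivity of \<open>U\<close>
  on points is what makes room for this. Then \<open>E {a, b}\<close> would exceed \<open>max (E {a}) (E {b})\<close>, which
  is impossible. So \<open>U\<close> is maxitive on pairs (\<open>maxitive_on_pairs\<close>). For a minimum of two possibility
  measures pairs are enough: the values of an event are attained by one point for each measure, so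
  the event has the same upper probability as this pair of points.
\<close>

lemma possibility_measure_of_empty [simp]: "possibility_measure_of \<pi> {} = 0"
  by (simp add: possibility_measure_of_def)

lemma possibility_measure_of_singleton [simp]: "possibility_measure_of \<pi> {x} = \<pi> x"
  by (simp add: possibility_measure_of_def)

lemma possibility_measure_of_pair [simp]: "possibility_measure_of \<pi> {x, y} = max (\<pi> x) (\<pi> y)"
  by (simp add: possibility_measure_of_def)

lemma possibility_measure_of_upper: "x \<in> A \<Longrightarrow> \<pi> x \<le> possibility_measure_of \<pi> A"
  by (auto simp: possibility_measure_of_def)

lemma possibility_measure_of_attained:
  assumes "A \<noteq> {}"
  obtains x where "x \<in> A" "possibility_measure_of \<pi> A = \<pi> x"
proof -
  have "Max (\<pi> ` A) \<in> \<pi> ` A" using assms by (intro Max_in) auto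
  then obtain x where "x \<in> A" "Max (\<pi> ` A) = \<pi> x" by (rule imageE)
  then show ?thesis using assms that[of x] by (simp add: possibility_measure_of_def)
qed

lemma possibility_measure_of_mono:
  assumes "possibility_distribution \<pi>" "A \<subseteq> B"
  shows "possibility_measure_of \<pi> A \<le> possibility_measure_of \<pi> B"
proof (cases "A = {}")
  case True
  have "0 \<le> possibility_measure_of \<pi> B"
  proof (cases "B = {}")
    case False
    then obtain x where "possibility_measure_of \<pi> B = \<pi> x"
      by (rule possibility_measure_of_attained)
    then show ?thesis using assms(1) by (simp add: possibility_distribution_def)
  qed simp
  then show ?thesis using True by simp
next
  case False
  then obtain x where "x \<in> A" "possibility_measure_of \<pi> A = \<pi> x"
    by (rule possibility_measure_of_attained)
  then show ?thesis using assms(2) possibility_measure_of_upper[of x B \<pi>] by auto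
qed

lemma possibility_measure_of_le_1:
  assumes "possibility_distribution \<pi>"
  shows "possibility_measure_of \<pi> A \<le> 1"
proof (cases "A = {}")
  case False
  then obtain x where "possibility_measure_of \<pi> A = \<pi> x"
    by (rule possibility_measure_of_attained)
  then show ?thesis using assms by (simp add: possibility_distribution_def)
qed simp

lemma possibility_distribution_mode:
  assumes "possibility_distribution \<pi>"
  obtains z where "\<pi> z = 1"
proof -
  have "Max (range \<pi>) \<in> range \<pi>" by (intro Max_in) auto
  then obtain z where "Max (range \<pi>) = \<pi> z" by (rule imageE)
  then show ?thesis using assms that[of z] by (simp add: possibility_distribution_def)
qed

text \<open>An event containing \<open>z\<close> has upper probability 1, so it imposes no constraint. An event
  without \<open>z\<close> is only charged through \<open>a\<close> and \<open>b\<close>, and by monotonicity its constraint follows from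
  the one for its trace on \<open>{a, b}\<close>. The points may coincide, so that this also yields measures
  with two atoms.\<close>

lemma three_atoms_in_credal_set:
  fixes U :: "'a::finite set \<Rightarrow> real"
  assumes mono: "\<And>A B. A \<subseteq> B \<Longrightarrow> U A \<le> U B"
    and empty: "0 \<le> U {}" and mode: "1 \<le> U {z}"
    and nonneg: "0 \<le> \<alpha>" "0 \<le> \<beta>" and total: "\<alpha> + \<beta> \<le> 1"
    and single: "\<alpha> \<le> U {a}" "\<beta> \<le> U {b}" and pair: "\<alpha> + \<beta> \<le> U {a, b}"
  shows "(\<lambda>B. \<alpha> * indicator B a + \<beta> * indicator B b + (1 - \<alpha> - \<beta>) * indicator B z)
           \<in> credal_set U" (is "?Q \<in> _")
proof -
  have "finitely_additive_probability ?Q"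
    using nonneg total unfolding finitely_additive_probability_def
    by (auto simp: indicator_def algebra_simps)
  moreover have "?Q B \<le> U B" for B
  proof (cases "z \<in> B")
    case True
    have "?Q B \<le> 1" using True nonneg total by (auto simp: indicator_def)
    also have "1 \<le> U {z}" by (rule mode)
    also have "\<dots> \<le> U B" using True by (intro mono) auto
    finally show ?thesis .
  next
    case False
    consider "a \<in> B" "b \<in> B" | "a \<in> B" "b \<notin> B" | "a \<notin> B" "b \<in> B" | "a \<notin> B" "b \<notin> B" by blast
    then show ?thesis
    proof cases
      case 1
      then show ?thesis using False pair mono[of "{a, b}" B] by simp
    next
      case 2
      then show ?thesis using False single mono[of "{a}" B] by simp
    next
      case 3
      then show ?thesis using False single mono[of "{b}" B] by simp
    next
      case 4
      then show ?thesis using False empty mono[of "{}" B] by simp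
    qed
  qed
  ultimately show ?thesis by (simp add: credal_set_def)
qed

lemma natural_extension_le:
  assumes "avoids_sure_loss U"
  shows "natural_extension U A \<le> U A"
  using natural_extension_attained(1)[OF assms, of A] by (auto simp: credal_set_def)

text \<open>Possibility measures are coherent. The measure that attains the value of \<open>A\<close> puts mass
  \<open>\<pi> x\<close> on a most possible point \<open>x\<close> of \<open>A\<close> and the remaining mass on a point of possibility 1,
  which lies outside \<open>A\<close> unless the value of \<open>A\<close> is already 1.\<close>

lemma natural_extension_possibility_measure:
  assumes "possibility_measure U"
  shows "avoids_sure_loss U" and "natural_extension U = U"
proof -
  obtain \<pi> where \<pi>: "possibility_distribution \<pi>" and U: "U = possibility_measure_of \<pi>"
    using assms by (auto simp: possibility_measure_def)
  obtain z where z: "\<pi> z = 1" using \<pi> by (rule possibility_distribution_mode)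
  have bounds: "0 \<le> \<pi> x" "\<pi> x \<le> 1" for x
    using \<pi> by (auto simp: possibility_distribution_def)
  have atom: "(\<lambda>B. \<pi> x * indicator B x + 0 * indicator B x + (1 - \<pi> x - 0) * indicator B z)
      \<in> credal_set U" for x
    by (rule three_atoms_in_credal_set)
       (use bounds z \<pi> possibility_measure_of_mono in \<open>auto simp: U\<close>)
  show asl: "avoids_sure_loss U" using atom by (auto simp: avoids_sure_loss_def)
  have "U A \<le> natural_extension U A" for A
  proof (cases "A = {}")
    case True
    obtain Q where "Q \<in> credal_set U" "natural_extension U A = Q A"
      using natural_extension_attained(1)[OF asl] by blast
    then have "0 \<le> natural_extension U A"
      by (simp add: credal_set_def finitely_additive_probability_def)
    then show ?thesis using True by (simp add: U)
  next
    case False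
    then obtain x where x: "x \<in> A" "possibility_measure_of \<pi> A = \<pi> x"
      by (rule possibility_measure_of_attained)
    have "U A = \<pi> x" using x by (simp add: U)
    also have "\<dots> \<le> \<pi> x * indicator A x + 0 * indicator A x + (1 - \<pi> x - 0) * indicator A z"
      using x bounds[of x] by (simp add: indicator_def)
    also have "\<dots> \<le> natural_extension U A"
      by (rule natural_extension_attained(2)[OF asl atom])
    finally show ?thesis .
  qed
  then show "natural_extension U = U"
    using natural_extension_le[OF asl] by (intro ext antisym)
qed

text \<open>A possibility measure has a point of value 1, and this survives in the larger function.\<close>

lemma natural_extension_possibility_imp_mode:
  assumes "avoids_sure_loss U" "possibility_measure (natural_extension U)"
  obtains z where "1 \<le> U {z}"
proof -
  obtain \<rho> where \<rho>: "possibility_distribution \<rho>"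
    and E: "natural_extension U = possibility_measure_of \<rho>"
    using assms(2) by (auto simp: possibility_measure_def)
  obtain z where "\<rho> z = 1" using \<rho> by (rule possibility_distribution_mode)
  then have "1 \<le> U {z}" using natural_extension_le[OF assms(1), of "{z}"] by (simp add: E)
  then show ?thesis by (rule that)
qed

text \<open>If the value of the pair exceeded those of its points, a measure could give the pair more
  than either \<open>U {a}\<close> or \<open>U {b}\<close>, whereas the natural extension of a point is at most its value
  under \<open>U\<close>.\<close>

lemma maxitive_on_pairs:
  fixes U :: "'a::finite set \<Rightarrow> real"
  assumes mono: "\<And>A B. A \<subseteq> B \<Longrightarrow> U A \<le> U B"
    and empty: "0 \<le> U {}" and le_1: "\<And>A. U A \<le> 1" and pos: "\<And>x. 0 < U {x}"
    and asl: "avoids_sure_loss U" and poss: "possibility_measure (natural_extension U)"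
  shows "U {a, b} = max (U {a}) (U {b})"
proof (rule ccontr)
  assume "U {a, b} \<noteq> max (U {a}) (U {b})"
  moreover have "U {a} \<le> U {a, b}" "U {b} \<le> U {a, b}" by (auto intro: mono)
  ultimately have gap: "U {a} < U {a, b}" "U {b} < U {a, b}" by (auto simp: max_def split: if_splits)
  then have "a \<noteq> b" by auto
  obtain z where z: "1 \<le> U {z}"
    using asl poss by (rule natural_extension_possibility_imp_mode)
  define \<alpha> where "\<alpha> = U {a}"
  \<comment> \<open>the largest mass on \<open>b\<close> that the constraints allow next to \<open>\<alpha>\<close>; the total is then
    \<open>min (U {a} + U {b}) (U {a, b})\<close>\<close>
  define \<beta> where "\<beta> = min (U {b}) (U {a, b} - U {a})"
  have masses: "0 \<le> \<alpha>" "0 \<le> \<beta>" "\<alpha> \<le> U {a}" "\<beta> \<le> U {b}" "\<alpha> + \<beta> \<le> U {a, b}"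
    and above: "U {a} < \<alpha> + \<beta>" "U {b} < \<alpha> + \<beta>"
    using gap pos[of a] pos[of b] by (auto simp: \<alpha>_def \<beta>_def)
  have "(\<lambda>B. \<alpha> * indicator B a + \<beta> * indicator B b + (1 - \<alpha> - \<beta>) * indicator B z)
      \<in> credal_set U" (is "?Q \<in> _")
    using masses le_1[of "{a, b}"] by (intro three_atoms_in_credal_set mono empty z) auto
  then have "?Q {a, b} \<le> natural_extension U {a, b}"
    by (rule natural_extension_attained(2)[OF asl])
  moreover have "\<alpha> + \<beta> \<le> ?Q {a, b}"
    using masses le_1[of "{a, b}"] by (simp add: indicator_def)
  moreover obtain \<rho> where E: "natural_extension U = possibility_measure_of \<rho>"
    using poss by (auto simp: possibility_measure_def)
  then have "natural_extension U {a, b} \<le> max (U {a}) (U {b})"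
    using natural_extension_le[OF asl, of "{a}"] natural_extension_le[OF asl, of "{b}"]
    by (auto simp: max_def)
  ultimately show False using above by linarith
qed

theorem theorem22:
  fixes \<pi>\<^sub>1 \<pi>\<^sub>2 :: "'a::finite \<Rightarrow> real" and P :: "'a set \<Rightarrow> real"
  assumes "possibility_distribution \<pi>\<^sub>1" and "possibility_distribution \<pi>\<^sub>2"
    and "\<And>x. \<pi>\<^sub>1 x > 0" and "\<And>x. \<pi>\<^sub>2 x > 0"
    and "\<And>A. P A = min (possibility_measure_of \<pi>\<^sub>1 A) (possibility_measure_of \<pi>\<^sub>2 A)"
  shows "(avoids_sure_loss P \<and> possibility_measure (natural_extension P))
           \<longleftrightarrow> possibility_measure P"
proof
  assume "possibility_measure P"
  then show "avoids_sure_loss P \<and> possibility_measure (natural_extension P)"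
    by (simp add: natural_extension_possibility_measure)
next
  assume "avoids_sure_loss P \<and> possibility_measure (natural_extension P)"
  then have asl: "avoids_sure_loss P" and poss: "possibility_measure (natural_extension P)"
    by auto
  have mono: "P A \<le> P B" if "A \<subseteq> B" for A B
    unfolding assms(5) using that assms(1,2) by (intro min.mono possibility_measure_of_mono)
  have empty: "P {} = 0" by (simp add: assms(5))
  have le_1: "P A \<le> 1" for A
    using possibility_measure_of_le_1[OF assms(1), of A] by (auto simp: assms(5))
  have pos: "0 < P {x}" for x using assms(3,4) by (simp add: assms(5))
  define \<pi> where "\<pi> x = P {x}" for x
  have "P A = possibility_measure_of \<pi> A" for A
  proof (cases "A = {}")
    case True
    then show ?thesis by (simp add: empty)
  next
    case False
    obtain a where a: "a \<in> A" "possibility_measure_of \<pi>\<^sub>1 A = \<pi>\<^sub>1 a"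
      using False by (rule possibility_measure_of_attained)
    obtain b where b: "b \<in> A" "possibility_measure_of \<pi>\<^sub>2 A = \<pi>\<^sub>2 b"
      using False by (rule possibility_measure_of_attained)
    have "P A \<le> P {a, b}" by (auto simp: assms(5) a b)
    also have "\<dots> = max (\<pi> a) (\<pi> b)"
      unfolding \<pi>_def by (rule maxitive_on_pairs) (auto intro: mono le_1 pos asl poss simp: empty)
    also have "\<dots> \<le> possibility_measure_of \<pi> A"
      using a b by (simp add: possibility_measure_of_upper)
    finally have "P A \<le> possibility_measure_of \<pi> A" .
    moreover obtain x where "x \<in> A" "possibility_measure_of \<pi> A = P {x}"
      unfolding \<pi>_def using False by (rule possibility_measure_of_attained)
    then have "possibility_measure_of \<pi> A \<le> P A" by (simp add: mono)
    ultimately show ?thesis by simp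
  qed
  moreover have "possibility_distribution \<pi>"
  proof -
    obtain z where "1 \<le> P {z}"
      using asl poss by (rule natural_extension_possibility_imp_mode)
    then have "\<pi> z = 1" using le_1[of "{z}"] by (simp add: \<pi>_def)
    moreover have "\<pi> x \<le> 1" for x by (simp add: \<pi>_def le_1)
    ultimately have "Max (range \<pi>) = 1"
      by (intro Max_eqI) (auto intro: rev_image_eqI)
    then show ?thesis
      using pos le_1 by (auto simp: possibility_distribution_def \<pi>_def intro: less_imp_le)
  qed
  ultimately show "possibility_measure P" by (auto simp: possibility_measure_def)
qed

end
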